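(* For every nonnegative integer $m$ one has $$\sum_{k=2^{n-1}}^{2^n}(-1)^k(\xi_{k,n})^m=\frac12+\frac{1}{2^{m+1}}+O(n^{-1}),\qquad n\to\infty,$$ where $0=\xi_{0,n}<\xi_{1,n}<\dots<\xi_{2^n,n}=1$ are the elements of the $n$-th Stern-Brocot sequence $F_n$ in increasing order (the implied constant may depend on $m$).
   Context: Stern-Brocot sequences: $F_0=\{0/1,1/1\}$. If $F_n$ is written in increasing order as $0=\xi_{0,n}<\xi_{1,n}<\dots<\xi_{2^n,n}=1$ with $\xi_{j,n}=p_{j,n}/q_{j,n}$ in lowest terms, then $F_{n+1}=F_n\cup W_{n+1}$, where $W_{n+1}=\left\{\frac{p_{j,n}+p_{j+1,n}}{q_{j,n}+q_{j+1,n}}: j=0,\dots,2^n-1\right\}$. Thus $|F_n|=2^n+1$. *)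

theory Defs
  imports Complex_Main "HOL-Library.Landau_Symbols"
begin

(* quotient_of r is the pair (p, q) with r = p/q in lowest terms and q > 0,
   so 0 and 1 are represented as 0/1 and 1/1. *)
definition mediant :: "rat \<Rightarrow> rat \<Rightarrow> rat" where
  "mediant x y =
     (let (p, q) = quotient_of x; (p', q') = quotient_of y
      in Fract (p + p') (q + q'))"

primrec stern_brocot :: "nat \<Rightarrow> rat set" where
  "stern_brocot 0 = {0, 1}"
| "stern_brocot (Suc n) =
     (let xs = sorted_list_of_set (stern_brocot n)
      in stern_brocot n \<union> {mediant (xs ! j) (xs ! Suc j) | j. j < 2 ^ n})"

(* The element number j, counted from 0, of the n-th sequence in increasing order;
   the value is meaningful for j \<le> 2 ^ n. *)
definition stern_brocot_nth :: "nat \<Rightarrow> nat \<Rightarrow> rat" where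
  "stern_brocot_nth n j = sorted_list_of_set (stern_brocot n) ! j"

end

theory Submission
  imports Defs
begin

text \<open>
  In the sum, the terms with even index are the fractions of level \<open>n - 1\<close> in \<open>[1/2, 1]\<close> and
  those with odd index are their mediants. Summation by parts turns it into
  \<open>(f(1/2) + f(1)) / 2\<close>, which for \<open>f(x) = x ^ m\<close> is the asserted main term, plus half the sum
  of the second differences \<open>f(a) + f(b) - 2 f(o)\<close> over neighbours \<open>a = p/q < b = p'/q'\<close> with
  mediant \<open>o\<close>. By Taylor's formula a second difference is \<open>f'(o)\<close> times the skewness
  \<open>(a - o) + (b - o) = (q - q') / (q q' (q + q'))\<close>, up to a multiple of the squared length of
  \<open>[a, b]\<close>. The lengths add up to at most 1 and each is \<open>O(1/n)\<close>, so the squares contribute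
  \<open>O(1/n)\<close>. The skewness is often as large as the length itself, and a bound for it has to
  use cancellation.

  Fix one interval with denominators \<open>q \<ge> q'\<close>, put \<open>u = q'/q\<close>, and add up the skewnesses of
  its descendants \<open>n\<close> levels below. The sum is \<open>g\<^sub>n(u) / q\<^sup>2\<close>, where \<open>g\<^sub>n\<close> arises from \<open>g\<^sub>0\<close> by
  the transfer operator of the Farey map with a minus sign on the branch that swaps the
  larger and the smaller denominator, applied \<open>n\<close> times. That operator preserves the nonnegative
  decreasing functions on \<open>(0, 1]\<close>
  (\<open>profile_antimono\<close>), so the negative branch may be dropped from upper bounds, and iterating
  the other branch alone gives \<open>0 \<le> g\<^sub>n(u) \<le> 1 / (u (1 + (n + 1) u))\<close> (\<open>profile_le\<close>). This is
  where the decay in \<open>n\<close> comes from.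

  The weight \<open>f'(o)\<close> is handled by replacing it by its value at the root of the tree, one
  generation at a time (\<open>level_sum_weighted_skew\<close>). Passing from an interval to its child with
  denominators \<open>x \<ge> y\<close> moves the mediant by \<open>1 / (x (x + y))\<close>, which is to be multiplied by the
  skewness sum of the child. All these errors together are \<open>O(1/n)\<close> because the sum of
  \<open>1 / (x y (x + y))\<close> over the infinite tree is finite; a potential function that drops by at
  least this amount from a node to its children proves it (\<open>potential_drop\<close>).
\<close>

section \<open>Subdividing an interval by mediants\<close>

text \<open>Fractions are kept as pairs (numerator, denominator), since mediants depend on the chosen
representation; the pairs that occur are reduced.\<close>

definition med :: "nat \<times> nat \<Rightarrow> nat \<times> nat \<Rightarrow> nat \<times> nat" where
  "med a b = (fst a + fst b, snd a + snd b)"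

definition val :: "nat \<times> nat \<Rightarrow> real" where
  "val a = real (fst a) / real (snd a)"

definition adjacent :: "nat \<times> nat \<Rightarrow> nat \<times> nat \<Rightarrow> bool" where
  "adjacent a b \<longleftrightarrow> snd a > 0 \<and> snd b > 0 \<and> fst b * snd a = fst a * snd b + 1"

text \<open>The endpoint number \<open>k\<close>, from the left and for \<open>k \<le> 2 ^ n\<close>, after \<open>n\<close> subdivisions of \<open>[a, b]\<close>.
The recursion splits off the first subdivision, so that sums over a level satisfy a recursion
in the root interval; \<open>node_even\<close> and \<open>node_odd\<close> describe the last subdivision instead, as the
Stern-Brocot sequences do.\<close>

primrec node :: "nat \<Rightarrow> nat \<times> nat \<Rightarrow> nat \<times> nat \<Rightarrow> nat \<Rightarrow> nat \<times> nat" where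
  "node 0 a b k = (if k = 0 then a else b)"
| "node (Suc n) a b k =
     (if k \<le> 2 ^ n then node n a (med a b) k else node n (med a b) b (k - 2 ^ n))"

lemma snd_med [simp]: "snd (med a b) = snd a + snd b"
  and fst_med [simp]: "fst (med a b) = fst a + fst b"
  by (simp_all add: med_def)

lemma adjacent_pos: "adjacent a b \<Longrightarrow> snd a > 0" "adjacent a b \<Longrightarrow> snd b > 0"
  by (simp_all add: adjacent_def)

lemma adjacent_med_left: "adjacent a b \<Longrightarrow> adjacent a (med a b)"
  and adjacent_med_right: "adjacent a b \<Longrightarrow> adjacent (med a b) b"
  by (auto simp: adjacent_def algebra_simps)

lemma val_diff:
  assumes "adjacent a b"
  shows "val b - val a = 1 / (real (snd a) * real (snd b))"
proof -
  have "real (fst b) * real (snd a) = real (fst a) * real (snd b) + 1"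
    using assms unfolding adjacent_def by (metis of_nat_1 of_nat_add of_nat_mult)
  then show ?thesis
    using adjacent_pos[OF assms] by (simp add: val_def field_simps)
qed

lemma val_less: "adjacent a b \<Longrightarrow> val a < val b"
  using val_diff[of a b] adjacent_pos[of a b]
  by (metis diff_gt_0_iff_gt mult_pos_pos of_nat_0_less_iff zero_less_divide_1_iff)

lemma val_nonneg: "0 \<le> val a"
  by (simp add: val_def)

lemma node_0 [simp]: "node n a b 0 = a"
  by (induction n arbitrary: a b) auto

lemma node_last [simp]: "node n a b (2 ^ n) = b"
  by (induction n arbitrary: a b) auto

lemma node_right: "node (Suc n) a b (2 ^ n + k) = node n (med a b) b k"
  by (cases "k = 0") auto

lemma adjacent_node:
  "adjacent a b \<Longrightarrow> k < 2 ^ n \<Longrightarrow> adjacent (node n a b k) (node n a b (Suc k))"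
proof (induction n arbitrary: a b k)
  case (Suc n)
  show ?case
  proof (cases "k < 2 ^ n")
    case True
    then show ?thesis using Suc.IH[OF adjacent_med_left[OF Suc.prems(1)]] by simp
  next
    case False
    then obtain j where j: "k = 2 ^ n + j" by (metis le_add_diff_inverse not_less)
    then have "j < 2 ^ n" using Suc.prems by simp
    then have "adjacent (node n (med a b) b j) (node n (med a b) b (Suc j))"
      using Suc.IH[OF adjacent_med_right[OF Suc.prems(1)]] by blast
    then show ?thesis
      using node_right[of n a b j] node_right[of n a b "Suc j"] j by (metis add_Suc_right)
  qed
qed auto

lemma snd_node_pos: "0 < snd a \<Longrightarrow> 0 < snd b \<Longrightarrow> 0 < snd (node n a b k)"
  by (induction n arbitrary: a b k) simp_all

lemma node_even: "k \<le> 2 ^ n \<Longrightarrow> node (Suc n) a b (2 * k) = node n a b k"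
proof (induction n arbitrary: a b k)
  case 0
  then show ?case by (cases k) auto
next
  case (Suc n)
  show ?case
  proof (cases "k \<le> 2 ^ n")
    case True
    have "node (Suc (Suc n)) a b (2 * k) = node (Suc n) a (med a b) (2 * k)"
      using True by simp
    also have "\<dots> = node n a (med a b) k" using Suc.IH[OF True] .
    finally show ?thesis using True by simp
  next
    case False
    then obtain j where j: "k = 2 ^ n + j" by (metis le_add_diff_inverse nat_le_linear)
    then have "j \<le> 2 ^ n" using Suc.prems by simp
    have "node (Suc (Suc n)) a b (2 * k) = node (Suc n) (med a b) b (2 * j)"
      using node_right[of "Suc n" a b "2 * j"] j by (simp add: algebra_simps del: node.simps)
    also have "\<dots> = node n (med a b) b j" using Suc.IH[OF \<open>j \<le> 2 ^ n\<close>] .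
    finally show ?thesis using node_right[of n a b j] j by simp
  qed
qed

lemma node_odd:
  "k < 2 ^ n \<Longrightarrow> node (Suc n) a b (Suc (2 * k)) = med (node n a b k) (node n a b (Suc k))"
proof (induction n arbitrary: a b k)
  case (Suc n)
  show ?case
  proof (cases "k < 2 ^ n")
    case True
    then have "node (Suc (Suc n)) a b (Suc (2 * k)) = node (Suc n) a (med a b) (Suc (2 * k))"
      by simp
    also have "\<dots> = med (node n a (med a b) k) (node n a (med a b) (Suc k))"
      using Suc.IH[OF True] .
    finally show ?thesis using True by simp
  next
    case False
    then obtain j where j: "k = 2 ^ n + j" by (metis le_add_diff_inverse not_less)
    then have "j < 2 ^ n" using Suc.prems by simp
    have "node (Suc (Suc n)) a b (Suc (2 * k)) = node (Suc n) (med a b) b (Suc (2 * j))"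
      using node_right[of "Suc n" a b "Suc (2 * j)"] j
      by (simp add: algebra_simps del: node.simps)
    also have "\<dots> = med (node n (med a b) b j) (node n (med a b) b (Suc j))"
      using Suc.IH[OF \<open>j < 2 ^ n\<close>] .
    finally show ?thesis
      using node_right[of n a b j] node_right[of n a b "Suc j"] j by (metis add_Suc_right)
  qed
qed simp

section \<open>The sequences in increasing order\<close>

definition rat_of_pair :: "nat \<times> nat \<Rightarrow> rat" where
  "rat_of_pair a = Fract (int (fst a)) (int (snd a))"

lemma real_of_rat_rat_of_pair: "snd a > 0 \<Longrightarrow> real_of_rat (rat_of_pair a) = val a"
  by (simp add: rat_of_pair_def val_def of_rat_rat)

lemma rat_of_pair_less:
  assumes "adjacent a b"
  shows "rat_of_pair a < rat_of_pair b"
  using val_less[OF assms] adjacent_pos[OF assms] real_of_rat_rat_of_pair of_rat_less by metis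

lemma adjacent_coprime:
  assumes "adjacent a b"
  shows "coprime (fst a) (snd a)" "coprime (fst b) (snd b)"
proof -
  have e: "fst b * snd a = fst a * snd b + 1" using assms by (simp add: adjacent_def)
  show "coprime (fst a) (snd a)"
  proof (rule coprimeI)
    fix c assume "c dvd fst a" "c dvd snd a"
    then show "is_unit c" using e by (metis dvd_add_right_iff dvd_mult dvd_mult2)
  qed
  show "coprime (fst b) (snd b)"
  proof (rule coprimeI)
    fix c assume "c dvd fst b" "c dvd snd b"
    then show "is_unit c" using e by (metis dvd_add_right_iff dvd_mult dvd_mult2)
  qed
qed

lemma mediant_rat_of_pair:
  assumes "adjacent a b"
  shows "mediant (rat_of_pair a) (rat_of_pair b) = rat_of_pair (med a b)"
proof -
  have "quotient_of (rat_of_pair c) = (int (fst c), int (snd c))"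
    if "coprime (fst c) (snd c)" "snd c > 0" for c
    using that unfolding rat_of_pair_def by (simp add: quotient_of_Fract normalize_stable)
  then show ?thesis
    using adjacent_coprime[OF assms] adjacent_pos[OF assms]
    by (simp add: mediant_def) (simp add: rat_of_pair_def)
qed

lemma sorted_list_of_set_image:
  fixes f :: "nat \<Rightarrow> 'a::linorder"
  assumes "\<And>k. k < n \<Longrightarrow> f k < f (Suc k)"
  shows "sorted_list_of_set (f ` {..n}) = map f [0..<Suc n]"
proof -
  have "f i < f j" if "i < j" "j \<le> n" for i j
    using that
  proof (induction j)
    case (Suc j)
    have "f j < f (Suc j)" using assms Suc.prems by simp
    moreover have "i = j \<or> f i < f j" using Suc.IH Suc.prems by (cases "i = j") auto
    ultimately show ?case by auto
  qed simp
  then have "sorted_wrt (<) (map f [0..<Suc n])"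
    unfolding sorted_wrt_iff_nth_less by (auto simp del: upt_Suc)
  moreover have "set (map f [0..<Suc n]) = f ` {..n}"
    by (auto simp: atLeast0LessThan lessThan_Suc_atMost simp del: upt_Suc)
  ultimately show ?thesis
    by (metis sorted_list_of_set.idem_if_sorted_distinct strict_sorted_iff)
qed

lemma stern_brocot_nth_eq:
  assumes "k \<le> 2 ^ n"
  shows "stern_brocot_nth n k = rat_of_pair (node n (0, 1) (1, 1) k)"
proof -
  define e where "e n k = node n (0, 1) (1, 1) k" for n k
  have adj: "adjacent (e n k) (e n (Suc k))" if "k < 2 ^ n" for n k
    unfolding e_def by (rule adjacent_node) (use that in \<open>auto simp: adjacent_def\<close>)
  have sl: "sorted_list_of_set ((\<lambda>k. rat_of_pair (e n k)) ` {..2 ^ n})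
      = map (\<lambda>k. rat_of_pair (e n k)) [0..<Suc (2 ^ n)]" for n
    by (rule sorted_list_of_set_image) (rule rat_of_pair_less[OF adj])
  have main: "stern_brocot n = (\<lambda>k. rat_of_pair (e n k)) ` {..2 ^ n}" for n
  proof (induction n)
    case 0
    show ?case by (auto simp: e_def rat_of_pair_def atMost_Suc Zero_rat_def One_rat_def)
  next
    case (Suc n)
    let ?xs = "map (\<lambda>k. rat_of_pair (e n k)) [0..<Suc (2 ^ n)]"
    have med_eq: "mediant (?xs ! j) (?xs ! Suc j) = rat_of_pair (e (Suc n) (Suc (2 * j)))" if "j < 2 ^ n" for j
      using that mediant_rat_of_pair[OF adj[OF that]] node_odd[OF that, of "(0,1)" "(1,1)"]
      unfolding e_def by (simp del: upt_Suc node.simps)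
    have "{mediant (?xs ! j) (?xs ! Suc j) | j. j < 2 ^ n}
        = {rat_of_pair (e (Suc n) (Suc (2 * j))) | j. j < 2 ^ n}"
      by (intro Collect_cong ex_cong1) (use med_eq in \<open>auto simp del: upt_Suc\<close>)
    moreover have "(\<lambda>k. rat_of_pair (e n k)) ` {..2 ^ n} = (\<lambda>k. rat_of_pair (e (Suc n) (2 * k))) ` {..2 ^ n}"
      unfolding e_def using node_even by (auto intro!: image_cong simp del: node.simps)
    moreover have "(\<lambda>k. rat_of_pair (e (Suc n) k)) ` {..2 ^ Suc n}
        = (\<lambda>k. rat_of_pair (e (Suc n) (2 * k))) ` {..2 ^ n} \<union> {rat_of_pair (e (Suc n) (Suc (2 * j))) | j. j < 2 ^ n}"
      (is "?L = ?A \<union> ?B")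
    proof
      show "?L \<subseteq> ?A \<union> ?B"
      proof
        fix x assume "x \<in> ?L"
        then obtain k where k: "k \<le> 2 ^ Suc n" "x = rat_of_pair (e (Suc n) k)" by auto
        show "x \<in> ?A \<union> ?B"
        proof (cases "even k")
          case True
          then obtain j where "k = 2 * j" by auto
          with k show ?thesis by auto
        next
          case False
          then obtain j where "k = Suc (2 * j)" by (auto elim!: oddE)
          with k show ?thesis by auto
        qed
      qed
    qed auto
    moreover have "stern_brocot (Suc n)
        = (\<lambda>k. rat_of_pair (e n k)) ` {..2 ^ n} \<union> {mediant (?xs ! j) (?xs ! Suc j) | j. j < 2 ^ n}"
      by (simp only: stern_brocot.simps Let_def Suc sl)
    ultimately show ?case by (simp only:)
  qed
  show ?thesis
    using assms unfolding stern_brocot_nth_def main sl by (simp add: e_def del: upt_Suc)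
qed

section \<open>Sums over the intervals of one level\<close>

primrec level_sum ::
  "(nat \<times> nat \<Rightarrow> nat \<times> nat \<Rightarrow> real) \<Rightarrow> nat \<Rightarrow> nat \<times> nat \<Rightarrow> nat \<times> nat \<Rightarrow> real" where
  "level_sum \<phi> 0 a b = \<phi> a b"
| "level_sum \<phi> (Suc n) a b = level_sum \<phi> n a (med a b) + level_sum \<phi> n (med a b) b"

lemma level_sum_eq_sum:
  "level_sum \<phi> n a b = (\<Sum>k<2 ^ n. \<phi> (node n a b k) (node n a b (Suc k)))"
proof (induction n arbitrary: a b)
  case (Suc n)
  let ?f = "\<lambda>k. \<phi> (node (Suc n) a b k) (node (Suc n) a b (Suc k))"
  have "(\<Sum>k<2 ^ Suc n. ?f k) = (\<Sum>k<2 ^ n. ?f k) + (\<Sum>k<2 ^ n. ?f (2 ^ n + k))"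
    using sum.atLeastLessThan_concat[of 0 "2 ^ n" "2 ^ n + 2 ^ n" ?f]
      sum.shift_bounds_nat_ivl[of ?f 0 "2 ^ n" "2 ^ n"]
    by (simp add: lessThan_atLeast0 mult_2 add.commute del: node.simps)
  moreover have "(\<Sum>k<2 ^ n. ?f k) = level_sum \<phi> n a (med a b)"
    unfolding Suc by (intro sum.cong) auto
  moreover have "(\<Sum>k<2 ^ n. ?f (2 ^ n + k)) = level_sum \<phi> n (med a b) b"
    unfolding Suc using node_right[of n a b] by (metis (no_types, lifting) add_Suc_right)
  ultimately show ?case by simp
qed simp

lemma level_sum_add:
  "level_sum (\<lambda>a b. \<phi> a b + \<psi> a b) n a b = level_sum \<phi> n a b + level_sum \<psi> n a b"
  by (induction n arbitrary: a b) auto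

text \<open>The even terms are endpoints of the previous level and the odd ones are mediants, so half of
every inner endpoint can be given to each of its two neighbouring intervals.\<close>

lemma alternating_sum_eq:
  fixes f :: "nat \<times> nat \<Rightarrow> real"
  shows "(\<Sum>k\<le>2 ^ Suc n. (- 1) ^ k * f (node (Suc n) a b k))
    = (f a + f b) / 2 + level_sum (\<lambda>a b. f a + f b - 2 * f (med a b)) n a b / 2"
proof -
  have alt: "(\<Sum>k\<le>2 * N. (- 1) ^ k * x k) = (x 0 + x (2 * N)) / 2
      + (\<Sum>k<N. x (2 * k) + x (2 * Suc k) - 2 * x (Suc (2 * k))) / 2" for N and x :: "nat \<Rightarrow> real"
    by (induction N) (auto simp: field_simps)
  have "node (Suc n) a b (2 + 2 * k) = node n a b (Suc k)" if "k < 2 ^ n" for k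
    using node_even[of "Suc k" n a b] that by (simp del: node.simps)
  then show ?thesis
    unfolding level_sum_eq_sum power_Suc alt
    using node_even[of 0 n a b] node_even[of "2 ^ n" n a b]
    by (auto intro!: sum.cong simp: node_even node_odd simp del: node.simps)
qed

section \<open>Level sums of the skewness\<close>

text \<open>The number \<open>(a - o) + (b - o)\<close>, where \<open>o\<close> is the mediant of the neighbours \<open>a\<close> and \<open>b\<close>: it
is what the linear Taylor terms at \<open>o\<close> leave of a second difference.\<close>

definition skew :: "nat \<times> nat \<Rightarrow> nat \<times> nat \<Rightarrow> real" where
  "skew a b = (real (snd a) - real (snd b)) / (real (snd a) * real (snd b) * real (snd a + snd b))"

text \<open>The skewness sums in homogeneous form. Since \<open>skew\<close> is homogeneous of degree \<open>-2\<close> and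
antisymmetric in the two denominators, a level sum is determined by the ratio \<open>u \<in> (0, 1]\<close> of the
smaller to the larger one. The children of the interval with denominators \<open>1\<close> and \<open>u\<close> have
denominators \<open>1 + u, u\<close> and \<open>1, 1 + u\<close>; in the second child the larger one has changed sides,
which causes the minus sign.\<close>

primrec profile :: "nat \<Rightarrow> real \<Rightarrow> real" where
  "profile 0 u = (1 - u) / (u * (1 + u))"
| "profile (Suc n) u = (profile n (u / (1 + u)) - profile n (1 / (1 + u))) / (1 + u)\<^sup>2"

text \<open>In the recursion the argument \<open>u / (1 + u)\<close> increases with \<open>u\<close> while \<open>1 / (1 + u)\<close> decreases,
and the former is at most the latter. Hence for a decreasing \<open>profile n\<close> the difference is again
decreasing and nonnegative, and so is its product with \<open>1 / (1 + u)\<^sup>2\<close>.\<close>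

lemma profile_antimono: "0 < u \<Longrightarrow> u \<le> v \<Longrightarrow> v \<le> 1 \<Longrightarrow> profile n v \<le> profile n u"
proof (induction n arbitrary: u v)
  case 0
  have "(1 - v) / (v * (1 + v)) \<le> (1 - u) / (u * (1 + u))"
    using 0 by (intro frac_le mult_mono) auto
  then show ?case by simp
next
  case (Suc n)
  let ?d = "\<lambda>w. profile n (w / (1 + w)) - profile n (1 / (1 + w))"
  have v: "0 < v" using Suc.prems by simp
  have "profile n (v / (1 + v)) \<le> profile n (u / (1 + u))"
    by (rule Suc.IH) (use Suc.prems v in \<open>auto simp: field_simps\<close>)
  moreover have "profile n (1 / (1 + u)) \<le> profile n (1 / (1 + v))"
    by (rule Suc.IH) (use Suc.prems v in \<open>auto simp: field_simps\<close>)
  moreover have "profile n (1 / (1 + v)) \<le> profile n (v / (1 + v))"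
    by (rule Suc.IH) (use Suc.prems v mult_le_one[of v v] in \<open>auto simp: field_simps\<close>)
  ultimately have "?d v / (1 + v)\<^sup>2 \<le> ?d u / (1 + u)\<^sup>2"
    using Suc.prems by (intro frac_le power_mono) auto
  then show ?case by simp
qed

lemma profile_nonneg: "0 < u \<Longrightarrow> u \<le> 1 \<Longrightarrow> 0 \<le> profile n u"
proof -
  assume u: "0 < u" "u \<le> 1"
  have "profile n 1 = 0" by (cases n) auto
  then show ?thesis using profile_antimono[OF u(1) u(2), of n] by simp
qed

text \<open>Dropping the subtracted nonnegative term leaves the branch \<open>u \<mapsto> u / (1 + u)\<close>, under which the
bound reproduces itself exactly with \<open>n + 1\<close> in place of \<open>n\<close>.\<close>

lemma profile_le: "0 < u \<Longrightarrow> u \<le> 1 \<Longrightarrow> profile n u \<le> 1 / (u * (1 + (real n + 1) * u))"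
proof (induction n arbitrary: u)
  case 0
  have "(1 - u) / (u * (1 + u)) \<le> 1 / (u * (1 + u))"
    using 0 by (intro divide_right_mono) auto
  then show ?case by simp
next
  case (Suc n)
  let ?v = "u / (1 + u)"
  have "profile (Suc n) u \<le> profile n ?v / (1 + u)\<^sup>2"
    using profile_nonneg[of "1 / (1 + u)" n] Suc.prems
    by (auto intro!: divide_right_mono simp: field_simps)
  also have "\<dots> \<le> 1 / (?v * (1 + (real n + 1) * ?v)) / (1 + u)\<^sup>2"
    using Suc.prems by (intro divide_right_mono Suc.IH) (auto simp: field_simps)
  also have "\<dots> = 1 / (u * (1 + (real (Suc n) + 1) * u))"
  proof -
    have "?v * (1 + (real n + 1) * ?v) * (1 + u)\<^sup>2 = u * (1 + (real (Suc n) + 1) * u)"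
    proof -
      have "1 + u \<noteq> 0" using Suc.prems by simp
      then show ?thesis
        by (simp add: divide_simps power2_eq_square) (simp add: algebra_simps)
    qed
    then show ?thesis by (simp only: divide_divide_eq_left)
  qed
  finally show ?case .
qed

lemma level_sum_skew_eq:
  assumes "0 < snd a" "0 < snd b"
  shows "level_sum skew n a b =
    (if snd b \<le> snd a then profile n (real (snd b) / real (snd a)) / (real (snd a))\<^sup>2
     else - profile n (real (snd a) / real (snd b)) / (real (snd b))\<^sup>2)"
  using assms
proof (induction n arbitrary: a b)
  case 0
  have "profile 0 (q / p) / p\<^sup>2 = (p - q) / (p * q * (p + q))"
    if "0 < p" "0 < q" for p q :: real
  proof -
    have nz: "p + q \<noteq> 0" "p \<noteq> 0" "q \<noteq> 0" using that by auto
    then have "1 - q / p = (p - q) / p" "1 + q / p = (p + q) / p" by (simp_all add: divide_simps)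
    with nz show ?thesis by (simp add: divide_simps power2_eq_square)
  qed
  from this[of "real (snd a)" "real (snd b)"] this[of "real (snd b)" "real (snd a)"] 0
  show ?case
    by (simp add: skew_def minus_divide_left add.commute mult.commute del: profile.simps)
next
  case (Suc n)
  define p q where "p = real (snd a)" and "q = real (snd b)"
  have pq: "0 < p" "0 < q" using Suc.prems by (auto simp: p_def q_def)
  have "level_sum skew (Suc n) a b
      = (profile n (q / (p + q)) - profile n (p / (p + q))) / (p + q)\<^sup>2"
    using Suc.IH[of a "med a b"] Suc.IH[of "med a b" b] Suc.prems
    by (simp add: p_def q_def diff_divide_distrib)
  moreover have "profile (Suc n) (q / p) / p\<^sup>2
      = (profile n (q / (p + q)) - profile n (p / (p + q))) / (p + q)\<^sup>2"
  proof -
    have "q / p / (1 + q / p) = q / (p + q)" "1 / (1 + q / p) = p / (p + q)"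
      "(1 + q / p)\<^sup>2 * p\<^sup>2 = (p + q)\<^sup>2"
      using pq by (auto simp: field_simps power2_eq_square)
    then show ?thesis by (simp only: profile.simps divide_divide_eq_left)
  qed
  moreover have "profile (Suc n) (p / q) / q\<^sup>2
      = (profile n (p / (p + q)) - profile n (q / (p + q))) / (p + q)\<^sup>2"
  proof -
    have "p / q / (1 + p / q) = p / (p + q)" "1 / (1 + p / q) = q / (p + q)"
      "(1 + p / q)\<^sup>2 * q\<^sup>2 = (p + q)\<^sup>2"
      using pq by (auto simp: field_simps power2_eq_square)
    then show ?thesis by (simp only: profile.simps divide_divide_eq_left)
  qed
  ultimately show ?case
    unfolding p_def[symmetric] q_def[symmetric]
    by (auto simp: minus_divide_left simp del: profile.simps)
qed

lemma abs_level_sum_skew_le: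
  assumes "0 < snd a" "0 < snd b"
  shows "snd a \<le> snd b \<Longrightarrow>
           \<bar>level_sum skew n a b\<bar> \<le> 1 / (real (snd a) * (real (snd b) + real n))"
    and "snd b \<le> snd a \<Longrightarrow>
           \<bar>level_sum skew n a b\<bar> \<le> 1 / (real (snd b) * (real (snd a) + real n))"
proof -
  have key: "\<bar>profile n (y / x) / x\<^sup>2\<bar> \<le> 1 / (y * (x + real n))" if "1 \<le> y" "y \<le> x" for x y :: real
  proof -
    have u: "0 < y / x" "y / x \<le> 1" using that by auto
    have "\<bar>profile n (y / x) / x\<^sup>2\<bar> = profile n (y / x) / x\<^sup>2"
      using profile_nonneg[OF u] by simp
    also have "\<dots> \<le> 1 / ((y / x) * (1 + (real n + 1) * (y / x))) / x\<^sup>2"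
      by (intro divide_right_mono profile_le u) simp
    also have "\<dots> = 1 / (y * (x + (real n + 1) * y))"
    proof -
      have "(y / x) * (1 + (real n + 1) * (y / x)) * x\<^sup>2 = y * (x + (real n + 1) * y)"
        using that by (simp add: field_simps power2_eq_square)
      then show ?thesis by (simp only: divide_divide_eq_left)
    qed
    also have "\<dots> \<le> 1 / (y * (x + real n))"
    proof -
      have "real n * 1 \<le> (real n + 1) * y" using that by (intro mult_mono) auto
      then show ?thesis using that
        by (intro divide_left_mono mult_left_mono mult_pos_pos add_pos_nonneg) auto
    qed
    finally show ?thesis .
  qed
  have ge1: "1 \<le> real (snd a)" "1 \<le> real (snd b)" using assms by auto
  have eq: "profile n 1 = 0" by (cases n) auto
  show "\<bar>level_sum skew n a b\<bar> \<le> 1 / (real (snd a) * (real (snd b) + real n))"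
    if "snd a \<le> snd b"
    using key[OF ge1(1), of "real (snd b)"] that assms eq unfolding level_sum_skew_eq[OF assms]
    by (auto simp: abs_minus_commute)
  show "\<bar>level_sum skew n a b\<bar> \<le> 1 / (real (snd b) * (real (snd a) + real n))"
    if "snd b \<le> snd a"
    using key[OF ge1(2), of "real (snd a)"] that assms unfolding level_sum_skew_eq[OF assms]
    by auto
qed

section \<open>Weighted level sums\<close>

text \<open>The two summands serve different regions of \<open>y \<le> x\<close>. From a node to its children the first drops by
\<open>(x - y) / (x\<^sup>2 y (x + y))\<close>, which is large enough unless \<open>y\<close> is close to \<open>x\<close>; the second drops by
an amount of order \<open>1 / x ^ 3\<close> everywhere and fills the gap. With the factor 3 the total drop is
exactly the required \<open>1 / (x y (x + y))\<close> at \<open>y = x\<close>.\<close>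

definition potential :: "real \<Rightarrow> real \<Rightarrow> real" where
  "potential x y = 1 / (x * y\<^sup>2) + 3 / (x * y * (x + y))"

lemma potential_nonneg: "0 < x \<Longrightarrow> 0 < y \<Longrightarrow> 0 \<le> potential x y"
  by (simp add: potential_def)

lemma potential_drop:
  assumes "0 < y" "y \<le> x"
  shows "1 / (x * y * (x + y)) + potential (x + y) y + potential (x + y) x \<le> potential x y"
proof -
  have x: "0 < x" using assms by simp
  then have nz: "x + y \<noteq> 0" "x \<noteq> 0" "y \<noteq> 0" "x + 2 * y \<noteq> 0" "2 * x + y \<noteq> 0"
    and "x + y + y = x + 2 * y" "x + y + x = 2 * x + y"
    using assms by auto
  have 1: "1 / (x * y\<^sup>2) - 1 / ((x + y) * y\<^sup>2) - 1 / ((x + y) * x\<^sup>2)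
      = (x - y) / (x\<^sup>2 * y * (x + y))"
    using nz by (simp add: divide_simps) algebra
  have 2: "3 / (x * y * (x + y)) - 3 / ((x + y) * y * (x + y + y)) - 3 / ((x + y) * x * (x + y + x))
      = 9 / ((x + y) * (x + 2 * y) * (2 * x + y))"
    unfolding \<open>x + y + y = x + 2 * y\<close> \<open>x + y + x = 2 * x + y\<close>
    using nz by (simp add: divide_simps)
  have 3: "9 / ((x + y) * (x + 2 * y) * (2 * x + y)) \<ge> 1 / (x\<^sup>2 * (x + y))"
  proof -
    have "(x + 2 * y) * (2 * x + y) \<le> (3 * x) * (3 * x)"
      using assms x by (intro mult_mono) auto
    then have "(x + y) * ((x + 2 * y) * (2 * x + y)) \<le> (x + y) * (9 * x\<^sup>2)"
      using assms x by (intro mult_left_mono) (auto simp: power2_eq_square)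
    then have "9 / ((x + y) * (9 * x\<^sup>2)) \<le> 9 / ((x + y) * ((x + 2 * y) * (2 * x + y)))"
      using assms x by (intro divide_left_mono) (auto intro!: mult_pos_pos add_pos_pos)
    moreover have "9 / ((x + y) * (9 * x\<^sup>2)) = 1 / (x\<^sup>2 * (x + y))" by simp
    ultimately show ?thesis by (simp only: mult.assoc)
  qed
  have 4: "(x - y) / (x\<^sup>2 * y * (x + y)) + 1 / (x\<^sup>2 * (x + y)) = 1 / (x * y * (x + y))"
    using nz by (simp add: divide_simps) algebra
  show ?thesis
    using 1 2 3 4 unfolding potential_def by linarith
qed

text \<open>Induction on the level. For a child with denominators \<open>x \<ge> y\<close> the change of the weight between the
mediants of parent and child is at most \<open>L / (x (x + y))\<close>, and the skewness sum below the child is at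
most \<open>1 / (y (x + n))\<close>. Their product plus the error already made below the child is
what \<open>potential_drop\<close> bounds by the potential of the child. The denominator of the bound survives
because \<open>x\<close> exceeds the larger denominator of the parent by at least 1, which compensates the lost
level.\<close>

lemma level_sum_weighted_skew:
  fixes h :: "real \<Rightarrow> real"
  assumes lip: "\<And>s t. 0 \<le> s \<Longrightarrow> s \<le> 1 \<Longrightarrow> 0 \<le> t \<Longrightarrow> t \<le> 1 \<Longrightarrow> \<bar>h s - h t\<bar> \<le> L * \<bar>s - t\<bar>"
    and "0 \<le> L" "adjacent a b" "val b \<le> 1"
  shows "\<bar>level_sum (\<lambda>a b. h (val (med a b)) * skew a b) n a b
            - h (val (med a b)) * level_sum skew n a b\<bar>
    \<le> L * (potential (real (snd a + snd b)) (real (snd a))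
          + potential (real (snd a + snd b)) (real (snd b)))
        / (real (max (snd a) (snd b)) + real n)"
  using assms(3,4)
proof (induction n arbitrary: a b)
  case 0
  then show ?case
    using adjacent_pos[of a b] \<open>0 \<le> L\<close>
    by (auto intro!: divide_nonneg_nonneg mult_nonneg_nonneg add_nonneg_nonneg potential_nonneg
        simp del: of_nat_max)
next
  case (Suc n)
  define m where "m = med a b"
  define p q where "p = real (snd a)" and "q = real (snd b)"
  define M where "M = real (max (snd a) (snd b)) + real (Suc n)"
  let ?T = "\<lambda>a b. level_sum (\<lambda>a b. h (val (med a b)) * skew a b) n a b"
  let ?S = "\<lambda>a b. level_sum skew n a b"
  have adj: "adjacent a m" "adjacent m b"
    using Suc.prems adjacent_med_left adjacent_med_right by (auto simp: m_def)
  have pos: "0 < snd a" "0 < snd b" using adjacent_pos[OF Suc.prems(1)] by auto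
  have pq: "0 < p" "0 < q" using pos by (auto simp: p_def q_def)
  have sm: "real (snd m) = p + q" by (simp add: m_def p_def q_def)
  have M: "0 < M" "M \<le> p + q + real n"
    using pos by (auto simp: M_def p_def q_def max_def)
  have bnd: "val m \<le> 1" using val_less[OF adj(2)] Suc.prems by simp
  \<comment> \<open>In both children the new denominator \<open>p + q\<close> is the larger one.\<close>
  have left: "\<bar>?T a m - h (val m) * ?S a m\<bar> \<le> L * potential (p + q) p / M"
  proof -
    define o' where "o' = med a m"
    have ao: "adjacent o' m" using adjacent_med_right[OF adj(1)] by (simp add: o'_def)
    have "\<bar>h (val o') - h (val m)\<bar> \<le> L * \<bar>val o' - val m\<bar>"
      using val_less[OF ao] bnd by (intro lip val_nonneg) auto
    also have "\<bar>val o' - val m\<bar> = 1 / ((p + (p + q)) * (p + q))"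
      using val_diff[OF ao] val_less[OF ao] sm by (simp add: o'_def p_def)
    finally have 1: "\<bar>h (val o') - h (val m)\<bar> \<le> L * (1 / ((p + (p + q)) * (p + q)))" .
    have 2: "\<bar>?S a m\<bar> \<le> 1 / (p * (p + q + real n))"
      using abs_level_sum_skew_le(1)[of a m n] adjacent_pos[OF adj(1)] sm
      by (simp add: p_def m_def)
    have "\<bar>h (val o') - h (val m)\<bar> * \<bar>?S a m\<bar>
        \<le> L * (1 / ((p + (p + q)) * (p + q))) * (1 / (p * (p + q + real n)))"
      using 1 2 pq \<open>0 \<le> L\<close> by (intro mult_mono) auto
    also have "\<dots> = L * (1 / ((p + q) * p * (p + q + p))) / (p + q + real n)"
      by (simp add: algebra_simps)
    finally have 3: "\<bar>(h (val o') - h (val m)) * ?S a m\<bar>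
        \<le> L * (1 / ((p + q) * p * (p + q + p))) / (p + q + real n)"
      by (simp add: abs_mult)
    have 4: "\<bar>?T a m - h (val o') * ?S a m\<bar>
        \<le> L * (potential (p + q + p) p + potential (p + q + p) (p + q)) / (p + q + real n)"
      using Suc.IH[OF adj(1) bnd] sm
      by (simp add: o'_def p_def[symmetric] m_def q_def[symmetric] add_ac)
    have "\<bar>?T a m - h (val m) * ?S a m\<bar>
        \<le> \<bar>?T a m - h (val o') * ?S a m\<bar> + \<bar>(h (val o') - h (val m)) * ?S a m\<bar>"
      by (simp add: left_diff_distrib)
    also have "\<dots> \<le> L * (1 / ((p + q) * p * (p + q + p)) + potential (p + q + p) p
        + potential (p + q + p) (p + q)) / (p + q + real n)"
      using 3 4 by (simp add: distrib_left add_divide_distrib)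
    also have "\<dots> \<le> L * potential (p + q) p / (p + q + real n)"
      using potential_drop[of p "p + q"] pq \<open>0 \<le> L\<close>
      by (intro divide_right_mono mult_left_mono) auto
    also have "\<dots> \<le> L * potential (p + q) p / M"
      using M pq \<open>0 \<le> L\<close> potential_nonneg[of "p + q" p] by (intro divide_left_mono) auto
    finally show ?thesis .
  qed
  have right: "\<bar>?T m b - h (val m) * ?S m b\<bar> \<le> L * potential (p + q) q / M"
  proof -
    define o' where "o' = med m b"
    have ao: "adjacent m o'" "adjacent o' b"
      using adjacent_med_left[OF adj(2)] adjacent_med_right[OF adj(2)] by (auto simp: o'_def)
    have "\<bar>h (val o') - h (val m)\<bar> \<le> L * \<bar>val o' - val m\<bar>"
      using val_less[OF ao(2)] bnd Suc.prems by (intro lip val_nonneg) auto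
    also have "\<bar>val o' - val m\<bar> = 1 / ((p + q) * (p + q + q))"
      using val_diff[OF ao(1)] val_less[OF ao(1)] sm by (simp add: o'_def q_def)
    finally have 1: "\<bar>h (val o') - h (val m)\<bar> \<le> L * (1 / ((p + q) * (p + q + q)))" .
    have 2: "\<bar>?S m b\<bar> \<le> 1 / (q * (p + q + real n))"
      using abs_level_sum_skew_le(2)[of m b n] adjacent_pos[OF adj(2)] sm
      by (simp add: q_def m_def)
    have "\<bar>h (val o') - h (val m)\<bar> * \<bar>?S m b\<bar>
        \<le> L * (1 / ((p + q) * (p + q + q))) * (1 / (q * (p + q + real n)))"
      using 1 2 pq \<open>0 \<le> L\<close> by (intro mult_mono) auto
    also have "\<dots> = L * (1 / ((p + q) * q * (p + q + q))) / (p + q + real n)"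
      by (simp add: algebra_simps)
    finally have 3: "\<bar>(h (val o') - h (val m)) * ?S m b\<bar>
        \<le> L * (1 / ((p + q) * q * (p + q + q))) / (p + q + real n)"
      by (simp add: abs_mult)
    have 4: "\<bar>?T m b - h (val o') * ?S m b\<bar>
        \<le> L * (potential (p + q + q) q + potential (p + q + q) (p + q)) / (p + q + real n)"
      using Suc.IH[OF adj(2)] Suc.prems sm
      by (simp add: o'_def p_def[symmetric] m_def q_def[symmetric] add_ac)
    have "\<bar>?T m b - h (val m) * ?S m b\<bar>
        \<le> \<bar>?T m b - h (val o') * ?S m b\<bar> + \<bar>(h (val o') - h (val m)) * ?S m b\<bar>"
      by (simp add: left_diff_distrib)
    also have "\<dots> \<le> L * (1 / ((p + q) * q * (p + q + q)) + potential (p + q + q) q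
        + potential (p + q + q) (p + q)) / (p + q + real n)"
      using 3 4 by (simp add: distrib_left add_divide_distrib)
    also have "\<dots> \<le> L * potential (p + q) q / (p + q + real n)"
      using potential_drop[of q "p + q"] pq \<open>0 \<le> L\<close>
      by (intro divide_right_mono mult_left_mono) auto
    also have "\<dots> \<le> L * potential (p + q) q / M"
      using M pq \<open>0 \<le> L\<close> potential_nonneg[of "p + q" q] by (intro divide_left_mono) auto
    finally show ?thesis .
  qed
  have "\<bar>(?T a m + ?T m b) - h (val m) * (?S a m + ?S m b)\<bar>
      \<le> L * potential (p + q) p / M + L * potential (p + q) q / M"
    using left right by (simp add: distrib_left)
  also have "\<dots> = L * (potential (p + q) p + potential (p + q) q) / M"
    by (simp add: distrib_left add_divide_distrib)
  finally show ?case
    by (simp add: m_def M_def p_def q_def)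
qed

text \<open>The lengths of the intervals of one level add up to the length of the root interval, and each of them
is at most \<open>1 / (max q q' + n)\<close>, because the larger denominator grows at every subdivision.\<close>

lemma level_sum_square_le:
  assumes "adjacent a b"
    and "\<And>a b. adjacent a b \<Longrightarrow> val b \<le> 1 \<Longrightarrow> \<bar>\<phi> a b\<bar> \<le> K * (val b - val a)\<^sup>2"
    and "0 \<le> K" "val b \<le> 1"
  shows "\<bar>level_sum \<phi> n a b\<bar> \<le> K * (val b - val a) / (real (max (snd a) (snd b)) + real n)"
  using assms(1,4)
proof (induction n arbitrary: a b)
  case 0
  let ?l = "val b - val a" and ?M = "real (max (snd a) (snd b))"
  have pos: "0 < snd a" "0 < snd b" using adjacent_pos[OF 0(1)] by auto
  then have "max (snd a) (snd b) \<le> snd a * snd b" by (auto simp: max_def)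
  then have "?M \<le> real (snd a) * real (snd b)" by (metis of_nat_le_iff of_nat_mult)
  then have "?l \<le> 1 / ?M"
    unfolding val_diff[OF 0(1)] using pos by (intro divide_left_mono) auto
  then have "K * (?l * ?l) \<le> K * (?l * (1 / ?M))"
    using val_less[OF 0(1)] \<open>0 \<le> K\<close> by (intro mult_left_mono) auto
  then show ?case using assms(2)[OF 0] by (simp add: power2_eq_square)
next
  case (Suc n)
  define m where "m = med a b"
  have adj: "adjacent a m" "adjacent m b"
    using Suc.prems adjacent_med_left adjacent_med_right by (auto simp: m_def)
  define M where "M = real (max (snd a) (snd b)) + real (Suc n)"
  have pos: "0 < snd a" "0 < snd b" using adjacent_pos[OF Suc.prems(1)] by auto
  have M: "0 < M" "M \<le> real (snd a + snd b) + real n" using pos by (auto simp: M_def max_def)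
  have mx: "max (snd a) (snd m) = snd a + snd b" "max (snd m) (snd b) = snd a + snd b"
    by (auto simp: m_def)
  have bnd: "val m \<le> 1" using val_less[OF adj(2)] Suc.prems by simp
  have "\<bar>level_sum \<phi> n a m\<bar> \<le> K * (val m - val a) / (real (snd a + snd b) + real n)"
    using Suc.IH[OF adj(1) bnd] unfolding mx .
  also have "\<dots> \<le> K * (val m - val a) / M"
    using M \<open>0 \<le> K\<close> val_less[OF adj(1)] by (intro divide_left_mono) auto
  finally have 1: "\<bar>level_sum \<phi> n a m\<bar> \<le> K * (val m - val a) / M" .
  have "\<bar>level_sum \<phi> n m b\<bar> \<le> K * (val b - val m) / (real (snd a + snd b) + real n)"
    using Suc.IH[OF adj(2) Suc.prems(2)] unfolding mx .
  also have "\<dots> \<le> K * (val b - val m) / M"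
    using M \<open>0 \<le> K\<close> val_less[OF adj(2)] by (intro divide_left_mono) auto
  finally have 2: "\<bar>level_sum \<phi> n m b\<bar> \<le> K * (val b - val m) / M" .
  have "\<bar>level_sum \<phi> n a m + level_sum \<phi> n m b\<bar>
      \<le> K * (val m - val a) / M + K * (val b - val m) / M"
    using 1 2 by linarith
  also have "\<dots> = K * (val b - val a) / M"
    by (simp add: algebra_simps flip: add_divide_distrib)
  finally show ?case by (simp add: m_def M_def)
qed

section \<open>Second differences of a smooth function\<close>

text \<open>Taylor's formula at the mediant splits the second difference into the weighted skewness and a
remainder \<open>R\<close> that is quadratic in the length of the interval.\<close>

lemma level_sum_second_difference_bound:
  fixes f h :: "real \<Rightarrow> real"
  assumes taylor: "\<And>s t. 0 \<le> s \<Longrightarrow> s \<le> 1 \<Longrightarrow> 0 \<le> t \<Longrightarrow> t \<le> 1 \<Longrightarrow>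
        \<bar>f t - f s - h s * (t - s)\<bar> \<le> K * (t - s)\<^sup>2"
    and lip: "\<And>s t. 0 \<le> s \<Longrightarrow> s \<le> 1 \<Longrightarrow> 0 \<le> t \<Longrightarrow> t \<le> 1 \<Longrightarrow> \<bar>h s - h t\<bar> \<le> L * \<bar>s - t\<bar>"
    and "0 \<le> K" "0 \<le> L" "adjacent a b" "val b \<le> 1"
  shows "\<exists>C. \<forall>n. \<bar>level_sum (\<lambda>a b. f (val a) + f (val b) - 2 * f (val (med a b))) n a b\<bar>
           \<le> C / (real (max (snd a) (snd b)) + real n)"
proof -
  define R where "R a b = f (val a) + f (val b) - 2 * f (val (med a b))
      - h (val (med a b)) * skew a b" for a b
  have R: "\<bar>R a b\<bar> \<le> K * (val b - val a)\<^sup>2" if adj: "adjacent a b" and b1: "val b \<le> 1" for a b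
  proof -
    define m where "m = med a b"
    have am: "adjacent a m" "adjacent m b"
      using adj adjacent_med_left adjacent_med_right by (auto simp: m_def)
    note lt = val_less[OF am(1)] val_less[OF am(2)]
    have skew: "skew a b = (val a - val m) + (val b - val m)"
    proof -
      have "val a - val m = - 1 / (real (snd a) * real (snd a + snd b))"
        "val b - val m = 1 / (real (snd a + snd b) * real (snd b))"
        using val_diff[OF am(1)] val_diff[OF am(2)] by (auto simp: m_def)
      moreover have "skew a b = - 1 / (real (snd a) * real (snd a + snd b))
          + 1 / (real (snd a + snd b) * real (snd b))"
        unfolding skew_def using adjacent_pos[OF adj]
        by (simp add: divide_simps)
      ultimately show ?thesis by simp
    qed
    have "R a b = (f (val a) - f (val m) - h (val m) * (val a - val m))
        + (f (val b) - f (val m) - h (val m) * (val b - val m))"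
      by (simp add: R_def skew algebra_simps flip: m_def)
    also have "\<bar>\<dots>\<bar> \<le> K * (val a - val m)\<^sup>2 + K * (val b - val m)\<^sup>2"
    proof -
      have "\<bar>f (val a) - f (val m) - h (val m) * (val a - val m)\<bar> \<le> K * (val a - val m)\<^sup>2"
        "\<bar>f (val b) - f (val m) - h (val m) * (val b - val m)\<bar> \<le> K * (val b - val m)\<^sup>2"
        using lt b1 by (auto intro!: taylor val_nonneg)
      then show ?thesis by linarith
    qed
    also have "\<dots> \<le> K * (val b - val a)\<^sup>2"
    proof -
      have "0 \<le> (val m - val a) * (val b - val m)" using lt by simp
      then have "(val a - val m)\<^sup>2 + (val b - val m)\<^sup>2 \<le> (val b - val a)\<^sup>2"
        by (simp add: power2_eq_square algebra_simps)
      then show ?thesis using mult_left_mono[OF _ \<open>0 \<le> K\<close>] by (metis distrib_left)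
    qed
    finally show ?thesis .
  qed
  let ?M = "\<lambda>n. real (max (snd a) (snd b)) + real n"
  let ?P = "potential (real (snd a + snd b)) (real (snd a))
      + potential (real (snd a + snd b)) (real (snd b))"
  let ?C = "L * ?P + \<bar>h (val (med a b))\<bar> + K * (val b - val a)"
  have pos: "0 < snd a" "0 < snd b" using adjacent_pos assms by auto
  have "\<bar>level_sum (\<lambda>a b. f (val a) + f (val b) - 2 * f (val (med a b))) n a b\<bar> \<le> ?C / ?M n" for n
  proof -
    let ?T = "level_sum (\<lambda>a b. h (val (med a b)) * skew a b) n a b"
    have split: "level_sum (\<lambda>a b. f (val a) + f (val b) - 2 * f (val (med a b))) n a b
        = ?T + level_sum R n a b"
    proof -
      have "(\<lambda>a b. f (val a) + f (val b) - 2 * f (val (med a b)))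
          = (\<lambda>a b. h (val (med a b)) * skew a b + R a b)"
        by (simp add: R_def fun_eq_iff)
      then show ?thesis by (simp only: level_sum_add)
    qed
    have "\<bar>level_sum skew n a b\<bar> \<le> 1 / ?M n"
    proof (cases "snd a \<le> snd b")
      case True
      have "1 / (real (snd a) * (real (snd b) + real n)) \<le> 1 / (1 * (real (snd b) + real n))"
        using pos by (intro divide_left_mono mult_right_mono) auto
      then show ?thesis using abs_level_sum_skew_le(1)[OF pos True, of n] True
        by (simp add: max_def)
    next
      case False
      have "1 / (real (snd b) * (real (snd a) + real n)) \<le> 1 / (1 * (real (snd a) + real n))"
        using pos by (intro divide_left_mono mult_right_mono) auto
      then show ?thesis using abs_level_sum_skew_le(2)[OF pos, of n] False
        by (simp add: max_def)
    qed
    then have "\<bar>h (val (med a b)) * level_sum skew n a b\<bar> \<le> \<bar>h (val (med a b))\<bar> * (1 / ?M n)"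
      unfolding abs_mult by (intro mult_left_mono) auto
    moreover have "\<bar>?T - h (val (med a b)) * level_sum skew n a b\<bar> \<le> L * ?P / ?M n"
      by (rule level_sum_weighted_skew[OF lip \<open>0 \<le> L\<close> assms(5,6)])
    moreover have "\<bar>level_sum R n a b\<bar> \<le> K * (val b - val a) / ?M n"
      by (rule level_sum_square_le[OF assms(5) R \<open>0 \<le> K\<close> assms(6)])
    moreover have "?C / ?M n = L * ?P / ?M n + \<bar>h (val (med a b))\<bar> * (1 / ?M n)
        + K * (val b - val a) / ?M n"
      by (simp add: add_divide_distrib)
    ultimately show ?thesis unfolding split by linarith
  qed
  then show ?thesis by blast
qed

lemma power_taylor_bound:
  fixes s t :: real
  assumes "0 \<le> s" "s \<le> 1" "0 \<le> t" "t \<le> 1"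
  shows "\<bar>t ^ m - s ^ m - real m * s ^ (m - 1) * (t - s)\<bar> \<le> (real m)\<^sup>2 * (t - s)\<^sup>2"
proof (induction m)
  case (Suc m)
  let ?r = "t ^ m - s ^ m - real m * s ^ (m - 1) * (t - s)"
  have "t ^ Suc m - s ^ Suc m - real (Suc m) * s ^ (Suc m - 1) * (t - s)
      = t * ?r + real m * s ^ (m - 1) * (t - s)\<^sup>2"
    by (cases m) (auto simp: algebra_simps power2_eq_square)
  also have "\<bar>\<dots>\<bar> \<le> \<bar>t * ?r\<bar> + \<bar>real m * s ^ (m - 1) * (t - s)\<^sup>2\<bar>"
    by (rule abs_triangle_ineq)
  also have "\<dots> \<le> 1 * ((real m)\<^sup>2 * (t - s)\<^sup>2) + real m * 1 * (t - s)\<^sup>2"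
  proof (rule add_mono)
    show "\<bar>t * ?r\<bar> \<le> 1 * ((real m)\<^sup>2 * (t - s)\<^sup>2)"
      unfolding abs_mult using assms Suc by (intro mult_mono) auto
    have "s ^ (m - 1) \<le> 1" using assms by (simp add: power_le_one)
    then have "real m * s ^ (m - 1) * (t - s)\<^sup>2 \<le> real m * 1 * (t - s)\<^sup>2"
      by (intro mult_right_mono mult_left_mono) auto
    then show "\<bar>real m * s ^ (m - 1) * (t - s)\<^sup>2\<bar> \<le> real m * 1 * (t - s)\<^sup>2"
      using assms by simp
  qed
  also have "\<dots> = ((real m)\<^sup>2 + real m) * (t - s)\<^sup>2" by (simp add: distrib_right)
  also have "\<dots> \<le> (real (Suc m))\<^sup>2 * (t - s)\<^sup>2"
    by (rule mult_right_mono[OF _ zero_le_power2]) (simp add: power2_eq_square algebra_simps)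
  finally show ?case .
qed simp

theorem corollary2:
  fixes m :: nat
  shows "(\<lambda>n::nat. (\<Sum>k = 2 ^ (n - 1)..2 ^ n. (- 1) ^ k * real_of_rat (stern_brocot_nth n k) ^ m)
            - (1 / 2 + 1 / 2 ^ (m + 1))) \<in> O(\<lambda>n. 1 / real n)"
proof -
  let ?d = "\<lambda>a b. val a ^ m + val b ^ m - 2 * val (med a b) ^ m"
  have lip: "\<bar>real m * s ^ (m - 1) - real m * t ^ (m - 1)\<bar> \<le> (real m)\<^sup>2 * \<bar>s - t\<bar>"
    if "0 \<le> s" "s \<le> 1" "0 \<le> t" "t \<le> 1" for s t :: real
  proof -
    have "\<bar>s ^ (m - 1) - t ^ (m - 1)\<bar> \<le> real (m - 1) * \<bar>s - t\<bar>"
      using norm_power_diff[of s t "m - 1"] that by simp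
    also have "\<dots> \<le> real m * \<bar>s - t\<bar>" by (intro mult_right_mono) auto
    finally have "real m * \<bar>s ^ (m - 1) - t ^ (m - 1)\<bar> \<le> real m * (real m * \<bar>s - t\<bar>)"
      by (intro mult_left_mono) auto
    then show ?thesis by (simp add: power2_eq_square abs_mult flip: right_diff_distrib)
  qed
  have adj: "adjacent (1, 2) (1, 1)" by (simp add: adjacent_def)
  have "\<exists>C. \<forall>n. \<bar>level_sum ?d n (1, 2) (1, 1)\<bar>
           \<le> C / (real (max (snd (1::nat, 2::nat)) (snd (1::nat, 1::nat))) + real n)"
  proof (rule level_sum_second_difference_bound[where K = "(real m)\<^sup>2" and L = "(real m)\<^sup>2"
        and h = "\<lambda>s. real m * s ^ (m - 1)" and f = "\<lambda>s. s ^ m"])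
    show "val (1, 1) \<le> 1" by (simp add: val_def)
  qed (use power_taylor_bound lip adj in simp_all)
  then obtain C where C0: "\<forall>n. \<bar>level_sum ?d n (1, 2) (1, 1)\<bar>
           \<le> C / (real (max (snd (1::nat, 2::nat)) (snd (1::nat, 1::nat))) + real n)" ..
  have C: "\<bar>level_sum ?d n (1, 2) (1, 1)\<bar> \<le> C / (2 + real n)" for n
    using C0[rule_format, of n] by simp
  have "\<bar>(\<Sum>k = 2 ^ (n - 1)..2 ^ n. (- 1) ^ k * real_of_rat (stern_brocot_nth n k) ^ m)
            - (1 / 2 + 1 / 2 ^ (m + 1))\<bar> \<le> C / 2 * (1 / real n)" if n2: "n \<ge> 2" for n
  proof -
    obtain N where "n = 2 + N" using le_Suc_ex[OF n2] by blast
    then have n: "n = Suc (Suc N)" by simp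
    have nth: "real_of_rat (stern_brocot_nth n (2 ^ Suc N + k)) = val (node (Suc N) (1, 2) (1, 1) k)"
      if "k \<le> 2 ^ Suc N" for k
    proof -
      have "stern_brocot_nth n (2 ^ Suc N + k) = rat_of_pair (node (Suc N) (1, 2) (1, 1) k)"
        using stern_brocot_nth_eq[of "2 ^ Suc N + k" n] that node_right[of "Suc N" "(0,1)" "(1,1)" k]
        by (simp add: n med_def numeral_2_eq_2 del: node.simps)
      moreover have "0 < snd (node (Suc N) (1, 2) (1, 1) k)"
        by (rule snd_node_pos) simp_all
      ultimately show ?thesis using real_of_rat_rat_of_pair by metis
    qed
    have "(\<Sum>k = 2 ^ (n - 1)..2 ^ n. (- 1) ^ k * real_of_rat (stern_brocot_nth n k) ^ m)
        = (\<Sum>k = 0 + 2 ^ Suc N..2 ^ Suc N + 2 ^ Suc N.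
             (- 1) ^ k * real_of_rat (stern_brocot_nth n k) ^ m)"
      by (simp add: n mult_2)
    also have "\<dots> = (\<Sum>k\<le>2 ^ Suc N.
        (- 1) ^ k * real_of_rat (stern_brocot_nth n (2 ^ Suc N + k)) ^ m)"
      unfolding sum.shift_bounds_cl_nat_ivl
      by (simp add: atLeast0AtMost power_add add.commute del: power_Suc)
    also have "\<dots> = (\<Sum>k\<le>2 ^ Suc N. (- 1) ^ k * val (node (Suc N) (1, 2) (1, 1) k) ^ m)"
      by (intro sum.cong) (auto simp: nth simp del: node.simps power_Suc)
    also have "\<dots> = (1 / 2 + 1 / 2 ^ (m + 1)) + level_sum ?d N (1, 2) (1, 1) / 2"
      unfolding alternating_sum_eq[where f = "\<lambda>a. val a ^ m"]
      by (simp add: val_def power_one_over field_simps)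
    finally have "\<bar>(\<Sum>k = 2 ^ (n - 1)..2 ^ n. (- 1) ^ k * real_of_rat (stern_brocot_nth n k) ^ m)
        - (1 / 2 + 1 / 2 ^ (m + 1))\<bar> = \<bar>level_sum ?d N (1, 2) (1, 1)\<bar> / 2"
      by (simp only: add_diff_cancel_left' abs_divide abs_numeral)
    also have "\<dots> \<le> C / (2 + real N) / 2"
      by (intro divide_right_mono C) simp
    also have "\<dots> = C / 2 * (1 / real n)" by (simp add: n)
    finally show ?thesis .
  qed
  then show ?thesis
    by (intro bigoI[of _ "C / 2"] eventually_mono[OF eventually_ge_at_top[of 2]]) auto
qed

end
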